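(* Let $k\geq 3$ and $m\geq 4$ be integers. (1) If $k\geq m-1$ and $n>m(k-(m-2))+(m-2)$, then $$\mathrm{sat}_k(n,\text{Berge-}C_m)\leq \left\lceil\frac{n-m+2}{k-m+2}\right\rceil.$$ (2) If $k=m-2$ and $n\geq m^2$, then $$\mathrm{sat}_k(n,\text{Berge-}C_m)\leq \left\lfloor\frac{n-1}{m-2}\right\rfloor\binom{m-1}{k}+\left\lceil\frac{(n-1)\bmod (m-2)}{k-2}\right\rceil.$$ (3) If $k\leq m-3$, $\ell=\max\{\lceil m/2\rceil+1,\,k+1\}$ and $n\geq \ell^2$, then $$\mathrm{sat}_k(n,\text{Berge-}C_m)\leq \left\lfloor\frac{n-1}{\ell-1}\right\rfloor\binom{\ell}{k}+\big((n-1)\bmod (\ell-1)\big)\binom{\ell}{k-1}.$$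
   Context: Hypergraphs are finite and have no repeated edges; a hypergraph is $k$-uniform if every edge has exactly $k$ vertices. $C_m$ is the graph cycle on $m$ vertices. For a graph $F$, a hypergraph $B$ is a Berge-$F$ if (with $V(F)$ identified with distinct vertices of $B$) there is a bijection $\phi:E(F)\to E(B)$ with $e\subseteq\phi(e)$ for all $e\in E(F)$. A hypergraph contains a Berge-$F$ if some subhypergraph of it is a Berge-$F$. A $k$-uniform hypergraph $H$ is Berge-$F$-saturated if $H$ contains no Berge-$F$, but for every $k$-subset $e$ of $V(H)$ with $e\notin E(H)$ the hypergraph $H+e$ contains a Berge-$F$. $\mathrm{sat}_k(n,\text{Berge-}F)$ is the minimum number of edges of a $k$-uniform Berge-$F$-saturated hypergraph on $n$ vertices. $a\bmod b$ denotes the remainder in $\{0,\dots,b-1\}$ of $a$ upon division by $b$. *)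

theory Defs
  imports Complex_Main
begin

text \<open>Edges form a set, so there are no repeated edges. A graph is a 2-uniform hypergraph.\<close>

record 'a hypergraph =
  verts :: "'a set"
  edges :: "'a set set"

definition hypergraph :: "'a hypergraph \<Rightarrow> bool" where
  "hypergraph H \<longleftrightarrow> finite (verts H) \<and> (\<forall>e\<in>edges H. e \<subseteq> verts H)"

definition uniform :: "nat \<Rightarrow> 'a hypergraph \<Rightarrow> bool" where
  "uniform k H \<longleftrightarrow> (\<forall>e\<in>edges H. card e = k)"

definition subhypergraph :: "'a hypergraph \<Rightarrow> 'a hypergraph \<Rightarrow> bool" where
  "subhypergraph B H \<longleftrightarrow> hypergraph B \<and> verts B \<subseteq> verts H \<and> edges B \<subseteq> edges H"

definition add_edge :: "'a hypergraph \<Rightarrow> 'a set \<Rightarrow> 'a hypergraph" where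
  "add_edge H e = \<lparr>verts = verts H, edges = insert e (edges H)\<rparr>"

text \<open>The cycle graph on \<open>m\<close> vertices, for \<open>m \<ge> 3\<close>.\<close>

definition cycle_graph :: "nat \<Rightarrow> nat hypergraph" where
  "cycle_graph m = \<lparr>verts = {..<m}, edges = {{i, Suc i mod m} | i. i < m}\<rparr>"

text \<open>The injection \<open>f\<close> is the identification of the vertices of the graph \<open>F\<close> with distinct
  vertices of \<open>B\<close>.\<close>

definition is_berge :: "'b hypergraph \<Rightarrow> 'a hypergraph \<Rightarrow> bool" where
  "is_berge F B \<longleftrightarrow>
     (\<exists>f \<phi>. inj_on f (verts F) \<and> f ` verts F \<subseteq> verts B \<and>
            bij_betw \<phi> (edges F) (edges B) \<and> (\<forall>e\<in>edges F. f ` e \<subseteq> \<phi> e))"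

definition contains_berge :: "'b hypergraph \<Rightarrow> 'a hypergraph \<Rightarrow> bool" where
  "contains_berge F H \<longleftrightarrow> (\<exists>B. subhypergraph B H \<and> is_berge F B)"

definition berge_saturated :: "nat \<Rightarrow> 'b hypergraph \<Rightarrow> 'a hypergraph \<Rightarrow> bool" where
  "berge_saturated k F H \<longleftrightarrow>
     hypergraph H \<and> uniform k H \<and> \<not> contains_berge F H \<and>
     (\<forall>e. e \<subseteq> verts H \<and> card e = k \<and> e \<notin> edges H \<longrightarrow> contains_berge F (add_edge H e))"

text \<open>Every finite hypergraph is isomorphic to one whose vertices are natural numbers, so that
  vertex type suffices. The infimum of the empty set of naturals would be \<open>0\<close>; the lemma
  \<open>berge_sat_attained\<close> below shows that it is a genuine minimum whenever \<open>F\<close> has an edge.\<close>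

definition berge_sat :: "nat \<Rightarrow> nat \<Rightarrow> 'b hypergraph \<Rightarrow> nat" where
  "berge_sat k n F =
     Inf {card (edges H) | H :: nat hypergraph. card (verts H) = n \<and> berge_saturated k F H}"

lemma berge_saturated_exists:
  assumes "edges F \<noteq> {}"
  shows "\<exists>H :: nat hypergraph. card (verts H) = n \<and> berge_saturated k F H"
proof -
  define K where "K = {e. e \<subseteq> {..<n} \<and> card e = k}"
  define G where "G E = \<lparr>verts = {..<n}, edges = E\<rparr>" for E :: "nat set set"
  define S where "S = {E. E \<subseteq> K \<and> \<not> contains_berge F (G E)}"
  have "finite K"
    unfolding K_def by (rule finite_subset[of _ "Pow {..<n}"]) auto
  then have fin: "finite S"
    by (rule rev_finite_subset[OF finite_Pow_iff[THEN iffD2]]) (auto simp: S_def)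
  have "\<not> contains_berge F (G {})"
    using assms by (auto simp: contains_berge_def is_berge_def subhypergraph_def G_def bij_betw_def)
  then have "{} \<in> S" by (simp add: S_def)
  with fin obtain E where E: "E \<in> S" and max: "\<And>E'. E' \<in> S \<Longrightarrow> E \<subseteq> E' \<Longrightarrow> E = E'"
    using finite_has_maximal[of S] by blast
  have "contains_berge F (add_edge (G E) e)" if "e \<in> K" "e \<notin> E" for e
  proof (rule ccontr)
    assume "\<not> contains_berge F (add_edge (G E) e)"
    then have "insert e E \<in> S"
      using E that by (auto simp: S_def G_def add_edge_def)
    with max that show False by blast
  qed
  then have "berge_saturated k F (G E)"
    using E by (auto simp: berge_saturated_def hypergraph_def uniform_def S_def K_def G_def)
  then show ?thesis by (intro exI[of _ "G E"]) (simp add: G_def)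
qed

lemma berge_sat_attained:
  assumes "edges F \<noteq> {}"
  shows "\<exists>H :: nat hypergraph. card (verts H) = n \<and> berge_saturated k F H \<and>
           card (edges H) = berge_sat k n F"
proof -
  let ?A = "{card (edges H) | H :: nat hypergraph. card (verts H) = n \<and> berge_saturated k F H}"
  have "?A \<noteq> {}" using berge_saturated_exists[OF assms] by blast
  then have "Inf ?A \<in> ?A" by (rule Inf_nat_def1)
  then show ?thesis unfolding berge_sat_def by force
qed

end

theory Submission
  imports Defs
begin

text \<open>
  Each bound comes from an explicit saturated hypergraph, of one of two shapes.

  For \<open>k \<ge> m - 1\<close>, fix a core of \<open>m - 2\<close> vertices, contained in every edge, and let the edges
  cover the other vertices by sets of size \<open>d = k - m + 2\<close>, pairwise disjoint except that two of
  them may overlap because of divisibility. A vertex of a Berge cycle lies in two of its edges, so a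
  cycle can leave the core only in the overlap, where both of its edges are determined; it does so
  at most once, and then it has at most \<open>m - 1\<close> vertices. A new edge contains two outside vertices
  without a common edge; join them to the two ends of a path through the whole core
  (\<open>berge_saturated_common_core\<close>).

  For \<open>k \<le> m - 2\<close>, glue complete \<open>k\<close>-uniform blocks of fewer than \<open>m\<close> vertices at one vertex \<open>v\<close>.
  Being a cut vertex, \<open>v\<close> confines every Berge cycle to one block, which is too small. In a complete
  block with more than \<open>k\<close> vertices any two vertices are joined by Berge paths of every length
  (\<open>berge_path_in_complete\<close>), so a new edge that meets two blocks away from \<open>v\<close> closes a cycle of
  length exactly \<open>m\<close> through \<open>v\<close>, provided that two blocks together have enough vertices
  (\<open>berge_saturated_glued_blocks\<close>).

  The vertices that remain when the blocks do not fit exactly are treated in two ways. If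
  \<open>k \<le> m - 3\<close>, blocks may have \<open>l\<close> or \<open>l + 1\<close> vertices, and each remaining vertex enlarges one block
  from \<open>l\<close> to \<open>l + 1\<close>, which costs \<open>l choose (k - 1)\<close> more edges. If \<open>k = m - 2\<close>, blocks have
  exactly \<open>m - 1\<close> vertices, and all remaining vertices go into one single edge through \<open>v\<close>. They
  have degree one and so are on no Berge cycle, while a new edge joining such a vertex to a block
  closes a cycle through all \<open>m - 1\<close> vertices of that block.
\<close>

section \<open>Berge cycles and Berge paths\<close>

lemma inj_on_cycle_edges:
  assumes "m \<ge> 3"
  shows "inj_on (\<lambda>i. {i, Suc i mod m}) {..<m}"
proof (rule inj_onI)
  fix i j assume "i \<in> {..<m}" "j \<in> {..<m}" and eq: "{i, Suc i mod m} = {j, Suc j mod m}"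
  then have ij: "i < m" "j < m" by auto
  have step: "Suc a mod m = (if Suc a = m then 0 else Suc a)" if "a < m" for a
    using that by (simp add: mod_Suc)
  have "i = j \<or> i = Suc j mod m \<and> j = Suc i mod m"
    using eq unfolding doubleton_eq_iff by metis
  then show "i = j"
    unfolding step[OF ij(1)] step[OF ij(2)] using assms by (auto split: if_splits)
qed

text \<open>This turns a Berge cycle into two sequences indexed by \<open>{..<m}\<close>, vertices and edges, without
  reference to a subhypergraph. The edges of the cycle graph are indexed by their first endpoint,
  which is possible because they are distinct for \<open>m \<ge> 3\<close>.\<close>

lemma contains_berge_cycle_iff:
  assumes m: "m \<ge> 3" and H: "hypergraph H"
  shows "contains_berge (cycle_graph m) H \<longleftrightarrow>
    (\<exists>f \<phi>. inj_on f {..<m} \<and> f ` {..<m} \<subseteq> verts H \<and> inj_on \<phi> {..<m} \<and>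
       (\<forall>i<m. \<phi> i \<in> edges H \<and> f i \<in> \<phi> i \<and> f (Suc i mod m) \<in> \<phi> i))"
    (is "_ \<longleftrightarrow> ?R")
proof
  let ?c = "\<lambda>i. {i, Suc i mod m}"
  have E: "edges (cycle_graph m) = ?c ` {..<m}" and V: "verts (cycle_graph m) = {..<m}"
    by (auto simp: cycle_graph_def)
  note injc = inj_on_cycle_edges[OF m]
  {
    assume "contains_berge (cycle_graph m) H"
    then obtain B f \<phi> where B: "subhypergraph B H" and f: "inj_on f {..<m}" "f ` {..<m} \<subseteq> verts B"
      and bij: "bij_betw \<phi> (?c ` {..<m}) (edges B)" and sub: "\<forall>e\<in>?c ` {..<m}. f ` e \<subseteq> \<phi> e"
      unfolding contains_berge_def is_berge_def E V by blast
    have "inj_on (\<lambda>i. \<phi> (?c i)) {..<m}"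
      using comp_inj_on[OF injc bij_betw_imp_inj_on[OF bij]] by (simp add: comp_def)
    moreover have "\<phi> (?c i) \<in> edges H" if "i < m" for i
      using B bij_betw_apply[OF bij, of "?c i"] that by (auto simp: subhypergraph_def)
    moreover have "f i \<in> \<phi> (?c i)" "f (Suc i mod m) \<in> \<phi> (?c i)" if "i < m" for i
      using sub that by auto
    moreover have "f ` {..<m} \<subseteq> verts H" using f B by (auto simp: subhypergraph_def)
    ultimately show ?R using f by (intro exI[of _ f] exI[of _ "\<lambda>i. \<phi> (?c i)"]) blast
  next
    assume ?R
    then obtain f \<phi> where f: "inj_on f {..<m}" "f ` {..<m} \<subseteq> verts H" and \<phi>: "inj_on \<phi> {..<m}"
      and c: "\<And>i. i < m \<Longrightarrow> \<phi> i \<in> edges H \<and> f i \<in> \<phi> i \<and> f (Suc i mod m) \<in> \<phi> i"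
      by blast
    define B where "B = \<lparr>verts = verts H, edges = \<phi> ` {..<m}\<rparr>"
    define \<psi> where "\<psi> e = \<phi> (the_inv_into {..<m} ?c e)" for e
    have \<psi>: "\<psi> (?c i) = \<phi> i" if "i < m" for i
      unfolding \<psi>_def using the_inv_into_f_f[OF injc, of i] that by simp
    have "subhypergraph B H"
      using H c by (auto simp: subhypergraph_def B_def hypergraph_def)
    moreover have "inj_on \<psi> (?c ` {..<m})"
    proof (rule inj_onI)
      fix x y assume "x \<in> ?c ` {..<m}" "y \<in> ?c ` {..<m}" and eq: "\<psi> x = \<psi> y"
      then obtain i j where ij: "i < m" "j < m" "x = ?c i" "y = ?c j" by blast
      then have "\<phi> i = \<phi> j" using eq \<psi> by simp
      then show "x = y" using inj_onD[OF \<phi>, of i j] ij by simp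
    qed
    moreover have "\<psi> ` ?c ` {..<m} = \<phi> ` {..<m}"
      using \<psi> by (simp add: image_image)
    moreover have "\<forall>e\<in>?c ` {..<m}. f ` e \<subseteq> \<psi> e"
      using \<psi> c by auto
    ultimately show "contains_berge (cycle_graph m) H"
      unfolding contains_berge_def is_berge_def E V
      by (intro exI[of _ B] conjI exI[of _ f] exI[of _ \<psi>])
        (use f in \<open>auto simp: bij_betw_def B_def\<close>)
  }
qed

definition berge_walk :: "'a list \<Rightarrow> 'a set list \<Rightarrow> bool" where
  "berge_walk xs es \<longleftrightarrow> length xs = Suc (length es) \<and>
     (\<forall>i<length es. xs ! i \<in> es ! i \<and> xs ! Suc i \<in> es ! i)"

lemma berge_walk_append:
  assumes "berge_walk (xs @ [v]) es" "berge_walk (v # ys) fs"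
  shows "berge_walk (xs @ v # ys) (es @ fs)"
proof -
  have len: "length es = length xs" "length fs = length ys"
    using assms by (auto simp: berge_walk_def)
  have "(xs @ v # ys) ! i \<in> (es @ fs) ! i \<and> (xs @ v # ys) ! Suc i \<in> (es @ fs) ! i"
    if i: "i < length (es @ fs)" for i
  proof (cases "i < length es")
    case True
    then have "(xs @ [v]) ! i \<in> es ! i" "(xs @ [v]) ! Suc i \<in> es ! i"
      using assms(1) by (auto simp: berge_walk_def)
    moreover have "(xs @ v # ys) ! i = (xs @ [v]) ! i" "(xs @ v # ys) ! Suc i = (xs @ [v]) ! Suc i"
      using True len by (auto simp: nth_append nth_Cons split: nat.splits)
    ultimately show ?thesis using True by (simp add: nth_append)
  next
    case False
    then obtain j where j: "i = length es + j" "j < length fs"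
      using i by (metis add_diff_inverse_nat length_append nat_add_left_cancel_less)
    then have "(v # ys) ! j \<in> fs ! j" "(v # ys) ! Suc j \<in> fs ! j"
      using assms(2) by (auto simp: berge_walk_def)
    then show ?thesis using j len by (simp add: nth_append)
  qed
  with len show ?thesis by (simp add: berge_walk_def)
qed

text \<open>The form in which saturation is always checked: the new edge closes a Berge path on \<open>m\<close>
  vertices.\<close>

lemma contains_berge_cycle_if_walk:
  assumes m: "m \<ge> 3" and H: "hypergraph H" and e: "e \<subseteq> verts H" "e \<notin> edges H"
    and walk: "berge_walk xs es" and dist: "distinct xs" "distinct es" and len: "length xs = m"
    and sub: "set xs \<subseteq> verts H" "set es \<subseteq> edges H"
    and ends: "hd xs \<in> e" "last xs \<in> e"
  shows "contains_berge (cycle_graph m) (add_edge H e)"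
proof -
  have les: "length es = m - 1" using walk len by (auto simp: berge_walk_def)
  have ne: "xs \<noteq> []" using len m by auto
  let ?\<phi> = "\<lambda>i. (es @ [e]) ! i"
  have H': "hypergraph (add_edge H e)" using H e by (auto simp: hypergraph_def add_edge_def)
  have "inj_on (\<lambda>i. xs ! i) {..<m}" using dist len by (simp add: inj_on_nth)
  moreover have "(\<lambda>i. xs ! i) ` {..<m} \<subseteq> verts (add_edge H e)"
    using sub len by (auto simp: add_edge_def)
  moreover have "inj_on ?\<phi> {..<m}"
    by (rule inj_on_nth) (use dist e sub les m in auto)
  moreover have "?\<phi> i \<in> edges (add_edge H e) \<and> xs ! i \<in> ?\<phi> i \<and> xs ! (Suc i mod m) \<in> ?\<phi> i"
    if i: "i < m" for i
  proof (cases "i = m - 1")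
    case True
    then have "Suc i = m" using m by simp
    then have "Suc i mod m = 0" by simp
    then show ?thesis
      using True ends les ne len by (simp add: nth_append add_edge_def hd_conv_nth last_conv_nth)
  next
    case False
    then have i': "i < length es" using i les by simp
    then have "Suc i mod m = Suc i" using les by auto
    moreover have "es ! i \<in> edges H" using i' sub nth_mem by blast
    ultimately show ?thesis
      using i' walk by (simp add: nth_append add_edge_def berge_walk_def)
  qed
  ultimately show ?thesis
    unfolding contains_berge_cycle_iff[OF m H']
    by (intro exI[of _ "\<lambda>i. xs ! i"] exI[of _ ?\<phi>]) blast
qed

lemma mod_eq_if_less_double:
  fixes a l :: nat
  assumes "a < 2 * l"
  shows "a mod l = (if a < l then a else a - l)"
  using assms by (auto simp: le_mod_geq)

abbreviation ksubsets :: "nat \<Rightarrow> 'a set \<Rightarrow> 'a set set" where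
  "ksubsets k B \<equiv> {s. s \<subseteq> B \<and> card s = k}"

text \<open>Arrange the block cyclically, with \<open>x\<close> and \<open>y\<close> at distance \<open>p\<close>, and use for the step from
  position \<open>i\<close> to \<open>i + 1\<close> the cyclic interval of length \<open>k\<close> that starts at \<open>i\<close>. Since \<open>k\<close> is smaller
  than the size of the block, an interval determines its starting point, so the edges are
  distinct.\<close>

lemma berge_path_in_complete:
  assumes fin: "finite B" and k: "2 \<le> k" "k < card B"
    and x: "x \<in> B" and y: "y \<in> B" and xy: "x \<noteq> y" and p: "1 \<le> p" "p < card B"
  obtains xs es where "berge_walk xs es" "hd xs = x" "last xs = y" "length xs = Suc p"
    "distinct xs" "distinct es" "set xs \<subseteq> B" "set es \<subseteq> ksubsets k B"
proof -
  obtain us where us: "set us = B - {x, y}" "distinct us"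
    using finite_distinct_list[of "B - {x, y}"] fin by auto
  have lus: "length us = card B - 2"
    using us fin x y xy distinct_card[OF us(2)] by (simp add: card_Diff_subset)
  define w where "w = x # take (p - 1) us @ y # drop (p - 1) us"
  define l where "l = length w"
  have l: "l = card B" using lus k by (simp add: l_def w_def)
  have "set (take (p - 1) us) \<union> set (drop (p - 1) us) = set us"
    by (metis append_take_drop_id set_append)
  then have setw: "set w = B" using us x y by (auto simp: w_def)
  then have dw: "distinct w" using l l_def by (simp add: card_distinct)
  have w0: "w ! 0 = x" by (simp add: w_def)
  have wp: "w ! p = y" using p lus by (auto simp: w_def nth_Cons nth_append split: nat.splits)
  have inB: "w ! (a mod l) \<in> B" for a
    using setw k l by (metis l_def mod_less_divisor nth_mem less_nat_zero_code not_gr_zero)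
  have eqw: "w ! (a mod l) = w ! (b mod l) \<longleftrightarrow> a mod l = b mod l" for a b
    using nth_eq_iff_index_eq[OF dw, of "a mod l" "b mod l"] k l
    by (simp add: l_def[symmetric])
  define E where "E i = (\<lambda>j. w ! ((i + j) mod l)) ` {..<k}" for i
  have Esub: "E i \<in> ksubsets k B" for i
  proof -
    have "inj_on (\<lambda>j. w ! ((i + j) mod l)) {..<k}"
    proof (rule inj_onI)
      fix a b assume ab: "a \<in> {..<k}" "b \<in> {..<k}" "w ! ((i + a) mod l) = w ! ((i + b) mod l)"
      then have "(i + a) mod l = (i + b) mod l" by (simp add: eqw)
      moreover have "(i + c) mod l = (if i mod l + c < l then i mod l + c else i mod l + c - l)"
        if "c < l" for c
      proof -
        have "(i + c) mod l = (i mod l + c) mod l" by (simp add: mod_add_left_eq)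
        moreover have "i mod l + c < 2 * l" using that mod_less_divisor[of l i] k l by linarith
        ultimately show ?thesis by (simp add: mod_eq_if_less_double)
      qed
      ultimately show "a = b" using ab k l mod_less_divisor[of l i] by (auto split: if_splits)
    qed
    then show ?thesis using inB by (auto simp: E_def card_image)
  qed
  \<comment> \<open>If the intervals from \<open>i < j\<close> agreed, then \<open>j\<close> and hence also \<open>j - 1\<close> would belong to the first,
      but \<open>j - 1\<close> is not in the second, which is not the full cycle.\<close>
  have neq: "E i \<noteq> E j" if ij: "i < j" "j < l" for i j
  proof
    assume eq: "E i = E j"
    have "w ! j \<in> E j"
      unfolding E_def by (rule image_eqI[of _ _ 0]) (use ij k in auto)
    then have "w ! (j mod l) \<in> E i" using ij eq by simp
    then obtain a where a: "a < k" "w ! (j mod l) = w ! ((i + a) mod l)"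
      unfolding E_def by blast
    then have "j = (i + a) mod l" unfolding eqw using ij by simp
    then have "j = i + a"
      using a k l ij by (subst (asm) mod_eq_if_less_double) (auto split: if_splits)
    then have "w ! (j - 1) \<in> E i"
      unfolding E_def by (intro image_eqI[of _ _ "a - 1"]) (use ij a in auto)
    then have "w ! ((j - 1) mod l) \<in> E j" using ij eq by simp
    then obtain b where b: "b < k" "w ! ((j - 1) mod l) = w ! ((j + b) mod l)"
      unfolding E_def by blast
    then have "j - 1 = (j + b) mod l" unfolding eqw using ij by simp
    then show False
      using b k l ij by (subst (asm) mod_eq_if_less_double) (auto split: if_splits)
  qed
  show thesis
  proof (rule that[of "take (Suc p) w" "map E [0..<p]"])
    have pl: "p < length w" using p l l_def by simp
    show "berge_walk (take (Suc p) w) (map E [0..<p])"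
    proof -
      have "w ! i \<in> E i \<and> w ! Suc i \<in> E i" if "i < p" for i
      proof
        show "w ! i \<in> E i" unfolding E_def
          by (rule image_eqI[of _ _ 0]) (use that pl k l_def in auto)
        show "w ! Suc i \<in> E i" unfolding E_def
          by (rule image_eqI[of _ _ 1]) (use that pl k l_def in auto)
      qed
      then show ?thesis using pl by (auto simp: berge_walk_def)
    qed
    show "hd (take (Suc p) w) = x" by (simp add: w_def)
    show "last (take (Suc p) w) = y" using wp pl by (simp add: take_Suc_conv_app_nth)
    show "length (take (Suc p) w) = Suc p" using pl by simp
    show "distinct (take (Suc p) w)" using dw by simp
    show "distinct (map E [0..<p])"
    proof -
      have "inj_on E {0..<p}"
        by (rule inj_onI) (metis neq nat_neq_iff pl l_def atLeastLessThan_iff less_trans)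
      then show ?thesis by (simp add: distinct_map)
    qed
    show "set (take (Suc p) w) \<subseteq> B" using setw by (metis set_take_subset)
    show "set (map E [0..<p]) \<subseteq> ksubsets k B" using Esub by auto
  qed
qed

section \<open>Complete blocks glued at a vertex\<close>

text \<open>Every vertex of a Berge cycle lies in two edges, so only vertices of degree at least two
  matter; the hypothesis on edges allows vertices of degree one outside all blocks. Deleting \<open>v\<close> from
  the cycle leaves a path, or the whole cycle; consecutive vertices share a block, and a vertex other
  than \<open>v\<close> has only one block, so the block never changes along it.\<close>

lemma no_berge_cycle_in_glued_blocks:
  assumes m: "m \<ge> 3" and H: "hypergraph H"
    and glued: "\<And>i j. i \<in> I \<Longrightarrow> j \<in> I \<Longrightarrow> i \<noteq> j \<Longrightarrow> B i \<inter> B j \<subseteq> {v}"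
    and small: "\<And>i. i \<in> I \<Longrightarrow> finite (B i) \<and> card (B i) < m"
    and edge: "\<And>e. e \<in> edges H \<Longrightarrow>
      \<exists>i\<in>I. \<forall>x\<in>e. (\<exists>e'\<in>edges H. e' \<noteq> e \<and> x \<in> e') \<longrightarrow> x \<in> B i"
  shows "\<not> contains_berge (cycle_graph m) H"
proof
  assume "contains_berge (cycle_graph m) H"
  then obtain f \<phi> where f: "inj_on f {..<m}" and \<phi>: "inj_on \<phi> {..<m}"
    and c: "\<And>i. i < m \<Longrightarrow> \<phi> i \<in> edges H \<and> f i \<in> \<phi> i \<and> f (Suc i mod m) \<in> \<phi> i"
    unfolding contains_berge_cycle_iff[OF m H] by blast
  have common: "\<exists>i\<in>I. f a \<in> B i \<and> f (Suc a mod m) \<in> B i" if a: "a < m" for a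
  proof -
    define b where "b = Suc a mod m"
    define z where "z = (if a = 0 then m - 1 else a - 1)"
    have b: "b < m" "b \<noteq> a" "f b \<in> \<phi> a"
      using m a c[OF a] unfolding b_def by (auto simp: mod_Suc)
    have z: "z < m" "z \<noteq> a" using m a unfolding z_def by auto
    have "Suc z mod m = a" using m a unfolding z_def by (cases "a = 0") auto
    then have "f a \<in> \<phi> z" using c[OF z(1)] by simp
    have neq: "\<phi> b \<noteq> \<phi> a" "\<phi> z \<noteq> \<phi> a"
      using inj_onD[OF \<phi>, of b a] inj_onD[OF \<phi>, of z a] b z a by auto
    obtain i where "i \<in> I"
      and i: "\<And>x e'. x \<in> \<phi> a \<Longrightarrow> e' \<in> edges H \<Longrightarrow> e' \<noteq> \<phi> a \<Longrightarrow> x \<in> e' \<Longrightarrow> x \<in> B i"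
      using edge[of "\<phi> a"] c[OF a] by blast
    have "f a \<in> B i" by (rule i[of "f a" "\<phi> z"]) (use c[OF a] c[OF z(1)] neq \<open>f a \<in> \<phi> z\<close> in simp_all)
    moreover have "f b \<in> B i" by (rule i[of "f b" "\<phi> b"]) (use c[OF b(1)] neq b in simp_all)
    ultimately have "f a \<in> B i \<and> f (Suc a mod m) \<in> B i" unfolding b_def by simp
    then show ?thesis using \<open>i \<in> I\<close> by blast
  qed
  \<comment> \<open>Rotate the cycle so that \<open>v\<close>, if it occurs, is the starting vertex.\<close>
  obtain s where s: "s < m" "\<And>a. a < m \<Longrightarrow> f a = v \<Longrightarrow> a = s"
  proof (cases "\<exists>s<m. f s = v")
    case True
    then obtain s where s: "s < m" "f s = v" by blast
    show thesis
    proof (rule that[OF s(1)])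
      fix a assume "a < m" "f a = v"
      then show "a = s" using inj_onD[OF f, of a s] s by simp
    qed
  next
    case False
    then show thesis using that[of 0] m by auto
  qed
  define g where "g i = f ((s + i) mod m)" for i
  have g_common: "\<exists>j\<in>I. g i \<in> B j \<and> g (Suc i) \<in> B j" for i
    using common[of "(s + i) mod m"] m by (simp add: g_def mod_Suc_eq)
  have g_v: "g i \<noteq> v" if "1 \<le> i" "i < m" for i
  proof
    assume "g i = v"
    then have "(s + i) mod m = s" using s(2)[of "(s + i) mod m"] m by (simp add: g_def)
    then show False using that s(1) mod_eq_if_less_double[of "s + i" m] by (auto split: if_splits)
  qed
  obtain j where j: "j \<in> I" "g 0 \<in> B j" "g 1 \<in> B j" using g_common[of 0] by auto
  have g_B: "g (Suc i) \<in> B j" if "Suc i < m" for i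
    using that
  proof (induction i)
    case 0
    then show ?case using j by simp
  next
    case (Suc i)
    obtain j' where j': "j' \<in> I" "g (Suc i) \<in> B j'" "g (Suc (Suc i)) \<in> B j'"
      using g_common by blast
    then have "j' = j" using glued[of j j'] j Suc g_v[of "Suc i"] by auto
    then show ?case using j' by simp
  qed
  have "f ` {..<m} \<subseteq> B j"
  proof
    fix x assume "x \<in> f ` {..<m}"
    then obtain a where a: "a < m" "x = f a" by auto
    define i where "i = (if s \<le> a then a - s else a + m - s)"
    have "i < m" using a(1) s(1) by (auto simp: i_def)
    moreover have "(s + i) mod m = a"
      using a(1) s(1) mod_eq_if_less_double[of "s + i" m] by (auto simp: i_def split: if_splits)
    then have "g i = x" using a(2) by (simp add: g_def)
    ultimately show "x \<in> B j" using g_B j by (cases i) auto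
  qed
  then have "card (f ` {..<m}) \<le> card (B j)" using small j by (intro card_mono) auto
  then show False using card_image[OF f] small[OF j(1)] by simp
qed

lemma berge_cycle_via_glued_paths:
  assumes m: "m \<ge> 3" and H: "hypergraph H" and e: "e \<subseteq> verts H" "e \<notin> edges H"
    and w1: "berge_walk xs es" "distinct xs" "distinct es" "set xs \<subseteq> verts H" "set es \<subseteq> edges H"
    and w2: "berge_walk ys fs" "distinct ys" "distinct fs" "set ys \<subseteq> verts H" "set fs \<subseteq> edges H"
    and v: "last xs = v" "hd ys = v" and disj: "set xs \<inter> set ys \<subseteq> {v}" "set es \<inter> set fs = {}"
    and ends: "hd xs \<in> e" "last ys \<in> e" and len: "length xs + length ys = Suc m"
  shows "contains_berge (cycle_graph m) (add_edge H e)"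
proof -
  have ne: "xs \<noteq> []" "ys \<noteq> []" using w1(1) w2(1) by (auto simp: berge_walk_def)
  then obtain xs' ys' where eq: "xs = xs' @ [v]" "ys = v # ys'"
    using v by (metis append_butlast_last_id list.collapse)
  show ?thesis
  proof (rule contains_berge_cycle_if_walk[OF m H e, of "xs' @ v # ys'" "es @ fs"])
    show "berge_walk (xs' @ v # ys') (es @ fs)"
      using w1 w2 eq by (intro berge_walk_append) auto
    show "hd (xs' @ v # ys') \<in> e" using ends eq by (cases xs') auto
    show "last (xs' @ v # ys') \<in> e" using ends eq by auto
  qed (use w1 w2 eq disj len in auto)
qed

text \<open>The set \<open>R\<close> holds vertices outside all blocks. If it is nonempty, one pendant edge \<open>f\<close> covers it
  and attaches it at \<open>v\<close>, with the rest of \<open>f\<close> inside a single block, so that \<open>f\<close> does not connect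
  two blocks away from \<open>v\<close>; then all blocks must have exactly \<open>m - 1\<close> vertices. A missing edge
  either meets two blocks away from \<open>v\<close>, and a cycle arises from a Hamiltonian path of the first
  and a path of the right length in the second (\<open>m < 2 * l\<close> makes the second block large enough), or it joins
  \<open>R\<close> to a block, and \<open>f\<close> brings the path back to \<open>v\<close>. The only \<open>k\<close>-set inside \<open>insert v R\<close> that can
  exist is \<open>f\<close> itself.\<close>

lemma berge_saturated_glued_blocks:
  fixes B :: "'i \<Rightarrow> 'a set" and I :: "'i set" and R f :: "'a set" and k l m :: nat
  defines "E \<equiv> (\<Union>i\<in>I. ksubsets k (B i)) \<union> (if R = {} then {} else {f})"
  assumes k: "2 \<le> k" "k < l" and m: "m \<ge> 3" "m < 2 * l"
    and I: "finite I" and finB: "\<And>i. i \<in> I \<Longrightarrow> finite (B i)"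
    and cardB: "\<And>i. i \<in> I \<Longrightarrow> l \<le> card (B i) \<and> card (B i) < m"
    and v: "\<And>i. i \<in> I \<Longrightarrow> v \<in> B i"
    and glued: "\<And>i j. i \<in> I \<Longrightarrow> j \<in> I \<Longrightarrow> i \<noteq> j \<Longrightarrow> B i \<inter> B j \<subseteq> {v}"
    and R: "finite R" "\<And>i. i \<in> I \<Longrightarrow> R \<inter> B i = {}"
    and f: "R \<noteq> {} \<Longrightarrow> insert v R \<subseteq> f \<and> card f = k \<and> l = m - 1 \<and> (\<exists>i\<in>I. f \<subseteq> R \<union> B i)"
  shows "berge_saturated k (cycle_graph m) \<lparr>verts = (\<Union>i\<in>I. B i) \<union> R, edges = E\<rparr>"
proof -
  let ?H = "\<lparr>verts = (\<Union>i\<in>I. B i) \<union> R, edges = E\<rparr>"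
  have H: "hypergraph ?H"
    using I finB R(1) f by (fastforce simp: hypergraph_def E_def split: if_splits)
  have "uniform k ?H" using f by (auto simp: uniform_def E_def split: if_splits)
  moreover have "\<not> contains_berge (cycle_graph m) ?H"
  proof (rule no_berge_cycle_in_glued_blocks[OF m(1) H glued])
    fix e assume "e \<in> edges ?H"
    then have e: "e \<in> E" by simp
    show "\<exists>i\<in>I. \<forall>x\<in>e. (\<exists>e'\<in>edges ?H. e' \<noteq> e \<and> x \<in> e') \<longrightarrow> x \<in> B i"
    proof (cases "R \<noteq> {} \<and> e = f")
      case True
      then obtain i where i: "i \<in> I" "f \<subseteq> R \<union> B i" using f by blast
      have "x \<in> B i" if x: "x \<in> e" "e' \<in> E" "e' \<noteq> e" "x \<in> e'" for x e'
      proof -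
        have "\<exists>j\<in>I. e' \<subseteq> B j" using x True by (auto simp: E_def)
        then have "x \<notin> R" using x R by blast
        then show ?thesis using x True i by blast
      qed
      then show ?thesis using i by auto
    next
      case False
      then show ?thesis using e by (auto simp: E_def split: if_splits)
    qed
  qed (use finB cardB in auto)
  moreover have "contains_berge (cycle_graph m) (add_edge ?H e)"
    if e: "e \<subseteq> verts ?H" "card e = k" "e \<notin> edges ?H" for e
  proof (cases "e \<inter> R = {}")
    case True
    have "\<not> e \<subseteq> {v}" using e(2) k card_mono[of "{v}" e] by auto
    then obtain x where x: "x \<in> e" "x \<noteq> v" by blast
    then obtain i where i: "i \<in> I" "x \<in> B i" using e(1) True by auto
    have "\<not> e \<subseteq> B i" using e i by (auto simp: E_def)
    then obtain y where y: "y \<in> e" "y \<notin> B i" by blast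
    then obtain j where j: "j \<in> I" "y \<in> B j" using e(1) True by auto
    have yv: "y \<noteq> v" "i \<noteq> j" using y v i j by auto
    have p: "1 \<le> card (B i) - 1" "card (B i) - 1 < card (B i)" "k < card (B i)"
      using cardB[OF i(1)] k by linarith+
    obtain xs es where P: "berge_walk xs es" "hd xs = x" "last xs = v"
      "length xs = Suc (card (B i) - 1)" "distinct xs" "distinct es"
      "set xs \<subseteq> B i" "set es \<subseteq> ksubsets k (B i)"
      by (rule berge_path_in_complete[OF finB[OF i(1)] k(1) p(3) i(2) v[OF i(1)] x(2) p(1,2)])
    have q: "1 \<le> m - card (B i)" "m - card (B i) < card (B j)" "k < card (B j)"
      using cardB[OF i(1)] cardB[OF j(1)] m(2) k(2) by linarith+
    obtain ys fs where Q: "berge_walk ys fs" "hd ys = v" "last ys = y"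
      "length ys = Suc (m - card (B i))" "distinct ys" "distinct fs"
      "set ys \<subseteq> B j" "set fs \<subseteq> ksubsets k (B j)"
      by (rule berge_path_in_complete
          [OF finB[OF j(1)] k(1) q(3) v[OF j(1)] j(2) yv(1)[symmetric] q(1,2)])
    have "ksubsets k (B i) \<inter> ksubsets k (B j) = {}"
    proof (rule equals0I)
      fix s assume "s \<in> ksubsets k (B i) \<inter> ksubsets k (B j)"
      then have s: "s \<subseteq> B i" "s \<subseteq> B j" "card s = k" by simp_all
      then have "s \<subseteq> {v}" using glued[OF i(1) j(1) yv(2)] by blast
      then show False using s(3) k card_mono[of "{v}" s] by simp
    qed
    then have "set es \<inter> set fs = {}"
      using Int_mono[OF P(8) Q(8)] by (simp only: subset_empty)
    moreover have "set xs \<inter> set ys \<subseteq> {v}" using P(7) Q(7) glued[OF i(1) j(1) yv(2)] by blast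
    moreover have "length xs + length ys = Suc m" using P(4) Q(4) cardB[OF i(1)] k by auto
    moreover have "set xs \<subseteq> verts ?H" "set ys \<subseteq> verts ?H" using P(7) Q(7) i j by auto
    moreover have "set es \<subseteq> edges ?H" "set fs \<subseteq> edges ?H"
      using P(8) Q(8) i(1) j(1) unfolding E_def by auto
    moreover have "hd xs \<in> e" "last ys \<in> e" using P(2) Q(3) x(1) y(1) by simp_all
    ultimately show ?thesis
      using P(1,3,5,6) Q(1,2,5,6)
      by (intro berge_cycle_via_glued_paths[OF m(1) H e(1) e(3), of xs es ys fs v]) assumption+
  next
    case False
    then obtain z where z: "z \<in> e" "z \<in> R" by blast
    then have f: "insert v R \<subseteq> f" "card f = k" "l = m - 1" "f \<in> E" using f by (auto simp: E_def)
    have "\<not> e \<subseteq> insert v R"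
    proof
      assume "e \<subseteq> insert v R"
      moreover have "finite f" using f(2) k card.infinite[of f] by fastforce
      ultimately have "e = f" using f e by (intro card_subset_eq) auto
      then show False using f e by simp
    qed
    then obtain b where b: "b \<in> e" "b \<noteq> v" "b \<notin> R" by blast
    then obtain i where i: "i \<in> I" "b \<in> B i" using e(1) by auto
    have cB: "card (B i) = m - 1" using cardB[OF i(1)] f(3) k by auto
    have p: "1 \<le> m - 2" "m - 2 < card (B i)" "k < card (B i)"
      using cB m(1) k(2) f(3) by linarith+
    obtain xs es where P: "berge_walk xs es" "hd xs = b" "last xs = v"
      "length xs = Suc (m - 2)" "distinct xs" "distinct es"
      "set xs \<subseteq> B i" "set es \<subseteq> ksubsets k (B i)"
      by (rule berge_path_in_complete[OF finB[OF i(1)] k(1) p(3) i(2) v[OF i(1)] b(2) p(1,2)])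
    have zB: "z \<notin> B i" using z R(2)[OF i(1)] by blast
    moreover have "z \<noteq> v" using zB v[OF i(1)] by auto
    moreover have "z \<in> f" using f(1) z(2) by blast
    moreover have "f \<notin> set es" using P(8) zB \<open>z \<in> f\<close> by blast
    moreover have "berge_walk [v, z] [f]" using f(1) \<open>z \<in> f\<close> by (auto simp: berge_walk_def)
    moreover have "set xs \<subseteq> verts ?H" using P(7) i(1) by auto
    moreover have "set es \<subseteq> edges ?H" using P(8) i(1) unfolding E_def by auto
    moreover have "set [v, z] \<subseteq> verts ?H" using v[OF i(1)] i(1) z(2) by auto
    moreover have "hd xs \<in> e" using P(2) b(1) by simp
    moreover have "set xs \<inter> set [v, z] \<subseteq> {v}" using P(7) zB by auto
    moreover have "length xs + length [v, z] = Suc m" using P(4) m by simp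
    ultimately show ?thesis
      using P(1,3,5,6) z(1) f(4)
      by (intro berge_cycle_via_glued_paths[OF m(1) H e(1) e(3), of xs es "[v, z]" "[f]" v]) simp_all
  qed
  ultimately show ?thesis using H unfolding berge_saturated_def by blast
qed

lemma card_glued_blocks_le:
  fixes B :: "'i \<Rightarrow> 'a set" and R f :: "'a set"
  assumes "finite I" and fin: "\<And>i. i \<in> I \<Longrightarrow> finite (B i)"
  shows "card ((\<Union>i\<in>I. ksubsets k (B i)) \<union> (if R = {} then {} else {f}))
    \<le> (\<Sum>i\<in>I. card (B i) choose k) + (if R = {} then 0 else 1)"
proof -
  have "card (\<Union>i\<in>I. ksubsets k (B i)) \<le> (\<Sum>i\<in>I. card (ksubsets k (B i)))"
    by (rule card_UN_le[OF assms(1)])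
  also have "\<dots> = (\<Sum>i\<in>I. card (B i) choose k)"
    using fin by (intro sum.cong) (auto simp: n_subsets)
  finally show ?thesis
    using card_Un_le[of "\<Union>i\<in>I. ksubsets k (B i)" "if R = {} then {} else {f}"]
    by (auto split: if_splits)
qed

section \<open>Edges through a common core\<close>

text \<open>The sets in \<open>\<P>\<close> are what the edges add to the core \<open>S\<close>; only \<open>p1\<close> and \<open>p2\<close> may intersect. At a
  vertex outside \<open>S\<close> the two edges of a Berge cycle must be those of \<open>p1\<close> and \<open>p2\<close>, and in a cycle of
  length at least 3 a pair of edges is consecutive at one place only. So a Berge cycle has at most
  one vertex outside \<open>S\<close>, hence at most \<open>m - 1\<close> vertices.\<close>

lemma berge_saturated_common_core:
  fixes \<P> :: "'a set set" and S :: "'a set"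
  assumes m: "m \<ge> 3" and S: "finite S" "card S = m - 2"
    and P: "finite \<P>" "m - 1 \<le> card \<P>"
    and p: "\<And>p. p \<in> \<P> \<Longrightarrow> finite p \<and> card p = d \<and> p \<inter> S = {}"
    and d: "d \<ge> 1"
    and meet: "\<And>p q. p \<in> \<P> \<Longrightarrow> q \<in> \<P> \<Longrightarrow> p \<noteq> q \<Longrightarrow> p \<inter> q \<noteq> {} \<Longrightarrow> {p, q} = {p1, p2}"
  shows "berge_saturated (d + (m - 2)) (cycle_graph m)
    \<lparr>verts = S \<union> \<Union>\<P>, edges = (\<union>) S ` \<P>\<rparr>"
proof -
  let ?H = "\<lparr>verts = S \<union> \<Union>\<P>, edges = (\<union>) S ` \<P>\<rparr>"
  have H: "hypergraph ?H" using S P p by (auto simp: hypergraph_def)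
  have inj: "inj_on ((\<union>) S) \<P>"
    using p by (intro inj_onI) blast
  have "uniform (d + (m - 2)) ?H"
    using S p by (auto simp: uniform_def card_Un_disjoint Int_commute)
  moreover have "\<not> contains_berge (cycle_graph m) ?H"
  proof
    assume "contains_berge (cycle_graph m) ?H"
    then obtain f \<phi> where f: "inj_on f {..<m}" and \<phi>: "inj_on \<phi> {..<m}"
      and c: "\<And>i. i < m \<Longrightarrow> \<phi> i \<in> edges ?H \<and> f i \<in> \<phi> i \<and> f (Suc i mod m) \<in> \<phi> i"
      unfolding contains_berge_cycle_iff[OF m H] by blast
    have edges_at: "\<phi> ` {a, Suc a mod m} = {S \<union> p1, S \<union> p2}"
      if a: "a < m" "f (Suc a mod m) \<notin> S" for a
    proof -
      define b where "b = Suc a mod m"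
      have b: "b < m" "b \<noteq> a" using m a by (auto simp: b_def mod_Suc)
      obtain p q where pq: "p \<in> \<P>" "q \<in> \<P>" "\<phi> a = S \<union> p" "\<phi> b = S \<union> q"
        using c[OF a(1)] c[OF b(1)] by auto
      then have "f b \<in> p" "f b \<in> q" using c[OF a(1)] c[OF b(1)] a b_def by auto
      moreover have "p \<noteq> q" using pq inj_onD[OF \<phi>, of a b] a b by auto
      ultimately have "{p, q} = {p1, p2}" using meet pq by blast
      then show ?thesis using pq by (auto simp: b_def[symmetric] doubleton_eq_iff)
    qed
    \<comment> \<open>\<open>T\<close> indexes the cycle vertices outside the core, each by its predecessor.\<close>
    define T where "T = {a. a < m \<and> f (Suc a mod m) \<notin> S}"
    have "card T \<le> 1"
    proof -
      have "finite T" by (auto simp: T_def)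
      moreover have "\<forall>a\<in>T. \<forall>b\<in>T. a = b"
      proof (intro ballI)
        fix a b assume ab: "a \<in> T" "b \<in> T"
        then have "\<phi> ` {a, Suc a mod m} = \<phi> ` {b, Suc b mod m}"
          using edges_at by (auto simp: T_def simp del: image_insert)
        then have "{a, Suc a mod m} = {b, Suc b mod m}"
          using inj_on_image_eq_iff[OF \<phi>, of "{a, Suc a mod m}" "{b, Suc b mod m}"] ab m
          by (auto simp: T_def simp del: image_insert)
        then show "a = b" using inj_onD[OF inj_on_cycle_edges[OF m]] ab by (auto simp: T_def)
      qed
      ultimately show ?thesis by (simp add: card_le_Suc0_iff_eq)
    qed
    moreover have "card ({..<m} - T) \<le> card S"
    proof (rule card_inj_on_le)
      have "inj_on (\<lambda>a. Suc a mod m) {..<m}"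
      proof (rule inj_onI)
        fix a b assume ab: "a \<in> {..<m}" "b \<in> {..<m}" "Suc a mod m = Suc b mod m"
        have "Suc i mod m = (if Suc i = m then 0 else Suc i)" if "i < m" for i
          using that by (simp add: mod_Suc)
        from this[of a] this[of b] ab show "a = b" by (simp split: if_splits)
      qed
      then have "inj_on (f \<circ> (\<lambda>a. Suc a mod m)) {..<m}"
        using m by (intro comp_inj_on inj_on_subset[OF f]) auto
      then show "inj_on (f \<circ> (\<lambda>a. Suc a mod m)) ({..<m} - T)" by (rule inj_on_subset) auto
      show "(f \<circ> (\<lambda>a. Suc a mod m)) ` ({..<m} - T) \<subseteq> S" by (auto simp: T_def)
    qed (use S in auto)
    moreover have "card ({..<m} - T) = m - card T"
      by (subst card_Diff_subset) (auto simp: T_def)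
    ultimately show False using S m by auto
  qed
  moreover have "contains_berge (cycle_graph m) (add_edge ?H e)"
    if e: "e \<subseteq> verts ?H" "card e = d + (m - 2)" "e \<notin> edges ?H" for e
  proof -
    have notsub: "\<not> e \<subseteq> S \<union> p" if "p \<in> \<P>" for p
    proof
      assume "e \<subseteq> S \<union> p"
      moreover have "card (S \<union> p) = card e" "finite (S \<union> p)"
        using p[OF that] S e by (auto simp: card_Un_disjoint Int_commute)
      ultimately have "e = S \<union> p" by (intro card_subset_eq) auto
      then show False using e that by auto
    qed
    have "\<not> e \<subseteq> S" using e(2) d S card_mono[of S e] by auto
    then obtain x where "x \<in> e" "x \<notin> S" by blast
    then obtain p where x: "x \<in> e" "x \<in> p" "p \<in> \<P>" using e(1) by auto
    obtain y where "y \<in> e" "y \<notin> S \<union> p" using notsub[OF x(3)] by blast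
    then obtain q where y: "y \<in> e" "y \<notin> p" "y \<in> q" "q \<in> \<P>" using e(1) by auto
    \<comment> \<open>If \<open>x\<close> lies in the overlap of \<open>p\<close> and \<open>q\<close>, a third vertex \<open>z\<close> of \<open>e\<close> outside \<open>q\<close> can be
        paired with \<open>y\<close> or with \<open>x\<close>.\<close>
    have "\<exists>x y p q. x \<in> e \<and> y \<in> e \<and> x \<in> p \<and> y \<in> q \<and> p \<in> \<P> \<and> q \<in> \<P> \<and> x \<notin> q \<and> y \<notin> p"
    proof (cases "x \<in> q")
      case True
      then have pq: "{p, q} = {p1, p2}" using meet[of p q] x y by blast
      obtain z where "z \<in> e" "z \<notin> S \<union> q" using notsub[OF y(4)] by blast
      then obtain r where z: "z \<in> e" "z \<notin> q" "z \<in> r" "r \<in> \<P>" using e(1) by auto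
      show ?thesis
      proof (cases "z \<in> p")
        case False
        have "r \<inter> p = {}"
        proof (rule ccontr)
          assume "r \<inter> p \<noteq> {}"
          moreover have "r \<noteq> p" "r \<noteq> q" using z False by blast+
          ultimately have "{r, p} = {p, q}" using meet[OF z(4) x(3)] pq by simp
          with \<open>r \<noteq> p\<close> \<open>r \<noteq> q\<close> show False by (metis insertI1 insertE singletonD)
        qed
        then show ?thesis using x z False by blast
      qed (use x y z in blast)
    qed (use x y in blast)
    then obtain x y p q where xy: "x \<in> e" "y \<in> e" "x \<in> p" "y \<in> q" "p \<in> \<P>" "q \<in> \<P>" "x \<notin> q" "y \<notin> p"
      by blast
    have "p \<noteq> q" using xy by auto
    obtain ss where ss: "set ss = S" "distinct ss" using finite_distinct_list S by blast
    then have lss: "length ss = m - 2" using S distinct_card by fastforce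
    have "m - 3 \<le> card (\<P> - {p, q})" using P xy \<open>p \<noteq> q\<close> by (simp add: card_Diff_subset)
    then obtain \<Q> where Q: "\<Q> \<subseteq> \<P> - {p, q}" "card \<Q> = m - 3" "finite \<Q>"
      using obtain_subset_with_card_n by metis
    then obtain qs where qs: "set qs = \<Q>" "distinct qs" using finite_distinct_list by blast
    then have lqs: "length qs = m - 3" using Q distinct_card by fastforce
    let ?ps = "p # qs @ [q]"
    have dps: "distinct ?ps" "set ?ps \<subseteq> \<P>" using qs Q xy \<open>p \<noteq> q\<close> by auto
    show ?thesis
    proof (rule contains_berge_cycle_if_walk[OF m H e(1) e(3), of "x # ss @ [y]" "map ((\<union>) S) ?ps"])
      have "(x # ss @ [y]) ! i \<in> map ((\<union>) S) ?ps ! i \<and> (x # ss @ [y]) ! Suc i \<in> map ((\<union>) S) ?ps ! i"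
        if i: "i < length ?ps" for i
      proof -
        have "(x # ss @ [y]) ! i \<in> S \<union> ?ps ! i"
        proof (cases i)
          case 0
          then show ?thesis using xy(3) by simp
        next
          case (Suc j)
          then have "j < length ss" using i lss lqs m by simp
          moreover from this have "ss ! j \<in> S" using ss(1) nth_mem by blast
          ultimately show ?thesis using Suc by (simp add: nth_append)
        qed
        moreover have "(ss @ [y]) ! i \<in> S \<union> ?ps ! i"
        proof (cases "i < length ss")
          case True
          then have "ss ! i \<in> S" using ss nth_mem by blast
          then show ?thesis using True by (simp add: nth_append)
        next
          case False
          then have "i = Suc (length qs)" "i = length ss" using i lss lqs m by simp_all
          then show ?thesis using xy by (simp add: nth_append)
        qed
        ultimately show ?thesis using i by (simp only: nth_map nth_Cons_Suc)
      qed
      then show "berge_walk (x # ss @ [y]) (map ((\<union>) S) ?ps)"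
        using lss lqs m by (simp add: berge_walk_def)
      show "distinct (map ((\<union>) S) ?ps)"
        unfolding distinct_map using dps(1) inj_on_subset[OF inj dps(2)] by (rule conjI)
      show "set (map ((\<union>) S) ?ps) \<subseteq> edges ?H"
        unfolding set_map using image_mono[OF dps(2)] by simp
      have "x \<notin> S" "y \<notin> S" using p[OF xy(5)] p[OF xy(6)] xy(3,4) by blast+
      then show "distinct (x # ss @ [y])" using ss xy(3,8) by auto
      show "length (x # ss @ [y]) = m" using lss m by simp
      show "set (x # ss @ [y]) \<subseteq> verts ?H" using ss(1) xy(3-6) by auto
      show "hd (x # ss @ [y]) \<in> e" "last (x # ss @ [y]) \<in> e" using xy(1,2) by simp_all
    qed
  qed
  ultimately show ?thesis using H unfolding berge_saturated_def by blast
qed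

section \<open>Partitions and the resulting upper bounds\<close>

lemma partition_with_sizes:
  fixes s :: "nat \<Rightarrow> nat"
  assumes "finite X" "card X = (\<Sum>i<q. s i)"
  obtains A where "\<And>i. i < q \<Longrightarrow> card (A i) = s i" "(\<Union>i<q. A i) = X"
    "\<And>i j. i < q \<Longrightarrow> j < q \<Longrightarrow> i \<noteq> j \<Longrightarrow> A i \<inter> A j = {}"
proof -
  have "\<exists>A. (\<forall>i<q. card (A i) = s i) \<and> (\<Union>i<q. A i) = X \<and> (\<forall>i<q. \<forall>j<q. i \<noteq> j \<longrightarrow> A i \<inter> A j = {})"
    using assms
  proof (induction q arbitrary: X)
    case 0
    then show ?case by auto
  next
    case (Suc q)
    then obtain Y where Y: "Y \<subseteq> X" "card Y = s q"
      by (metis le_add2 obtain_subset_with_card_n sum.lessThan_Suc)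
    then have "card (X - Y) = (\<Sum>i<q. s i)"
      using Suc.prems by (simp add: card_Diff_subset finite_subset)
    then obtain A where A: "\<forall>i<q. card (A i) = s i" "(\<Union>i<q. A i) = X - Y"
      "\<forall>i<q. \<forall>j<q. i \<noteq> j \<longrightarrow> A i \<inter> A j = {}"
      using Suc.IH[of "X - Y"] Suc.prems by auto
    let ?A = "A(q := Y)"
    have old: "?A i = A i" "A i \<subseteq> X - Y" if "i < q" for i using that A by auto
    have "(\<Union>i<Suc q. ?A i) = Y \<union> (\<Union>i<q. A i)" using old by (auto simp: lessThan_Suc)
    then have "(\<Union>i<Suc q. ?A i) = X" using A Y by auto
    moreover have "?A i \<inter> ?A j = {}" if "i < Suc q" "j < Suc q" "i \<noteq> j" for i j
      using that A(3) old by (cases "i = q"; cases "j = q") (auto simp: less_Suc_eq)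
    ultimately show ?case
      using A(1) Y by (intro exI[of _ ?A]) (auto simp: less_Suc_eq)
  qed
  then show thesis using that by blast
qed

lemma berge_sat_le:
  fixes H :: "nat hypergraph"
  assumes "berge_saturated k F H" "card (verts H) = n" "card (edges H) \<le> b"
  shows "berge_sat k n F \<le> b"
proof -
  have "berge_sat k n F \<le> card (edges H)"
    unfolding berge_sat_def by (rule cInf_lower) (use assms in auto)
  then show ?thesis using assms(3) by simp
qed


text \<open>Outside the core, \<open>N div d\<close> disjoint sets of size \<open>d\<close> leave \<open>N mod d\<close> vertices; if there are
  any, one more set \<open>L\<close> covers them, filled up with vertices of the single set \<open>A 0\<close>. The bound
  \<open>m * d \<le> N\<close> provides enough edges for a path through the core.\<close>

lemma berge_sat_cycle_common_core_le:
  assumes m: "m \<ge> 3" and d: "d \<ge> 1" and N: "m * d \<le> N"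
  shows "berge_sat (d + (m - 2)) (N + (m - 2)) (cycle_graph m)
    \<le> N div d + (if N mod d = 0 then 0 else 1)"
proof -
  define q where "q = N div d"
  define r where "r = N mod d"
  have N_eq: "N = q * d + r" and rd: "r < d" using d by (auto simp: q_def r_def)
  have qm: "m \<le> q" using N d by (simp add: q_def less_eq_div_iff_mult_less_eq)
  define X where "X = {..<N}"
  define S where "S = {N..<N + (m - 2)}"
  obtain A where A: "\<And>i. i < Suc q \<Longrightarrow> card (A i) = (if i < q then d else r)"
    "(\<Union>i<Suc q. A i) = X" "\<And>i j. i < Suc q \<Longrightarrow> j < Suc q \<Longrightarrow> i \<noteq> j \<Longrightarrow> A i \<inter> A j = {}"
    by (rule partition_with_sizes[where X = X and q = "Suc q" and s = "\<lambda>i. if i < q then d else r"])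
      (auto simp: X_def N_eq)
  have finA: "finite (A i)" if "i < Suc q" for i
  proof (rule finite_subset)
    show "A i \<subseteq> X" unfolding A(2)[symmetric] using that by (intro UN_upper) simp
  qed (simp add: X_def)
  have q0: "0 < q" using qm m by simp
  then have "card (A 0) = d" using A(1)[of 0] by simp
  then obtain D where D: "D \<subseteq> A 0" "card D = d - r"
    using obtain_subset_with_card_n[of "d - r" "A 0"] by (metis diff_le_self)
  define L where "L = A q \<union> D"
  have finD: "finite D" using D finA[of 0] finite_subset by auto
  have disj0: "A q \<inter> A 0 = {}" using A(3)[of q 0] q0 by simp
  have L: "finite L" "card L = d"
  proof -
    have "card L = card (A q) + card D"
      unfolding L_def using finA[of q] finD disj0 D by (intro card_Un_disjoint) auto
    then show "card L = d" using A(1)[of q] D rd by simp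
    show "finite L" using finA[of q] finD by (simp add: L_def)
  qed
  define \<P> where "\<P> = A ` {..<q} \<union> (if r = 0 then {} else {L})"
  have Aq0: "A q = {}" if "r = 0" using A(1)[of q] finA[of q] that by simp
  have UnP: "\<Union>\<P> = X"
  proof -
    have "(\<Union>i<Suc q. A i) = A q \<union> (\<Union>i<q. A i)" by (auto simp: lessThan_Suc)
    moreover have "A 0 \<subseteq> (\<Union>i<q. A i)" using qm m by (intro UN_upper) auto
    then have "D \<subseteq> (\<Union>i<q. A i)" using D by blast
    ultimately show ?thesis using A(2) Aq0 by (auto simp: \<P>_def L_def)
  qed
  have p: "finite p \<and> card p = d \<and> p \<inter> S = {}" if "p \<in> \<P>" for p
  proof -
    have "p \<subseteq> X" using that UnP by blast
    then have "p \<inter> S = {}" by (auto simp: X_def S_def)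
    moreover have "finite p \<and> card p = d"
      using that A(1) finA L by (auto simp: \<P>_def split: if_splits)
    ultimately show ?thesis by simp
  qed
  have "inj_on A {..<q}"
  proof (rule inj_onI)
    fix i j assume ij: "i \<in> {..<q}" "j \<in> {..<q}" "A i = A j"
    then have "A i \<noteq> {}" using A(1)[of i] d by auto
    then show "i = j" using A(3)[of i j] ij by auto
  qed
  then have cA: "card (A ` {..<q}) = q" by (simp add: card_image)
  have cP: "card \<P> \<le> q + (if r = 0 then 0 else 1)"
    unfolding \<P>_def using card_Un_le[of "A ` {..<q}" "{L}"] cA by auto
  have "m - 1 \<le> card \<P>"
    using card_mono[of \<P> "A ` {..<q}"] cA qm by (auto simp: \<P>_def)
  have meetL: "i = 0" if "i < q" "A i \<inter> L \<noteq> {}" for i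
    using that A(3)[of i q] A(3)[of i 0] D qm by (auto simp: L_def)
  have "{p, p'} = {A 0, L}" if pp: "p \<in> \<P>" "p' \<in> \<P>" "p \<noteq> p'" "p \<inter> p' \<noteq> {}" for p p'
  proof -
    have "\<not> (p \<in> A ` {..<q} \<and> p' \<in> A ` {..<q})"
    proof
      assume "p \<in> A ` {..<q} \<and> p' \<in> A ` {..<q}"
      then obtain i j where "p = A i" "p' = A j" "i < q" "j < q" by auto
      then show False using pp A(3)[of i j] by auto
    qed
    then show ?thesis using pp meetL by (auto simp: \<P>_def Int_commute split: if_splits)
  qed
  then have "berge_saturated (d + (m - 2)) (cycle_graph m)
      \<lparr>verts = S \<union> \<Union>\<P>, edges = (\<union>) S ` \<P>\<rparr>"
    using \<open>m - 1 \<le> card \<P>\<close> p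
    by (intro berge_saturated_common_core[OF m _ _ _ _ _ d, where ?p1.0 = "A 0" and ?p2.0 = L])
      (simp_all add: S_def \<P>_def)
  moreover have "card (S \<union> \<Union>\<P>) = N + (m - 2)"
    unfolding UnP by (subst card_Un_disjoint) (auto simp: S_def X_def)
  moreover have "card ((\<union>) S ` \<P>) \<le> N div d + (if N mod d = 0 then 0 else 1)"
  proof -
    have "finite \<P>" by (simp add: \<P>_def)
    from order.trans[OF card_image_le[OF this] cP] show ?thesis
      unfolding q_def r_def .
  qed
  ultimately show ?thesis by (intro berge_sat_le) auto
qed

text \<open>Here \<open>m = k + 2\<close>. Each block is \<open>0\<close> with \<open>k\<close> further vertices, hence has
  \<open>k + 1\<close> edges. The leftover set \<open>R\<close> is the part with index \<open>q\<close> of the partition, and the pendant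
  edge is filled up from the block with index \<open>0\<close>. A single pendant edge always suffices, since
  fewer than \<open>k\<close> vertices are left over.\<close>

lemma berge_sat_cycle_pendant_edge_le:
  assumes k: "k \<ge> 3" and n: "n > k"
  shows "berge_sat k n (cycle_graph (k + 2))
    \<le> (n - 1) div k * Suc k + (if (n - 1) mod k = 0 then 0 else 1)"
proof -
  define q where "q = (n - 1) div k"
  define r where "r = (n - 1) mod k"
  have n_eq: "n - 1 = q * k + r" and rk: "r < k" using k by (auto simp: q_def r_def)
  have q: "q \<ge> 1" using n k by (simp add: q_def less_eq_div_iff_mult_less_eq)
  define X where "X = {1..<n}"
  obtain A where A: "\<And>i. i < Suc q \<Longrightarrow> card (A i) = (if i < q then k else r)"
    "(\<Union>i<Suc q. A i) = X" "\<And>i j. i < Suc q \<Longrightarrow> j < Suc q \<Longrightarrow> i \<noteq> j \<Longrightarrow> A i \<inter> A j = {}"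
    by (rule partition_with_sizes[where X = X and q = "Suc q" and s = "\<lambda>i. if i < q then k else r"])
      (use n_eq in \<open>auto simp: X_def\<close>)
  have finA: "finite (A i)" "0 \<notin> A i" if "i < Suc q" for i
  proof -
    have "A i \<subseteq> X" unfolding A(2)[symmetric] using that by (intro UN_upper) simp
    then show "finite (A i)" "0 \<notin> A i" unfolding X_def by (auto intro: finite_subset)
  qed
  define B where "B i = insert 0 (A i)" for i
  define R where "R = A q"
  have "card (A 0) = k" using A(1)[of 0] q by simp
  then have "k - 1 - r \<le> card (A 0)" by simp
  then obtain D where D: "D \<subseteq> A 0" "card D = k - 1 - r"
    by (metis obtain_subset_with_card_n)
  define f where "f = insert 0 (R \<union> D)"
  have cf: "card f = k"
  proof -
    have "finite D" "0 \<notin> D" using D finA[of 0] finite_subset by auto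
    moreover have "R \<inter> D = {}" using A(3)[of q 0] D q by (auto simp: R_def)
    ultimately show ?thesis
      using finA[of q] A(1)[of q] D rk by (simp add: f_def R_def card_Un_disjoint)
  qed
  have cB: "card (B i) = Suc k" if "i < q" for i
    using that finA[of i] A(1)[of i] by (simp add: B_def)
  let ?E = "(\<Union>i\<in>{..<q}. ksubsets k (B i)) \<union> (if R = {} then {} else {f})"
  have "berge_saturated k (cycle_graph (k + 2)) \<lparr>verts = (\<Union>i\<in>{..<q}. B i) \<union> R, edges = ?E\<rparr>"
  proof (rule berge_saturated_glued_blocks[where v = 0 and l = "Suc k"])
    show "B i \<inter> B j \<subseteq> {0}" if "i \<in> {..<q}" "j \<in> {..<q}" "i \<noteq> j" for i j
      using A(3)[of i j] that by (auto simp: B_def)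
    show "R \<inter> B i = {}" if "i \<in> {..<q}" for i
      using A(3)[of q i] finA[of q] that by (auto simp: B_def R_def)
    show "insert 0 R \<subseteq> f \<and> card f = k \<and> Suc k = k + 2 - 1 \<and> (\<exists>i\<in>{..<q}. f \<subseteq> R \<union> B i)"
      using cf D q by (auto simp: f_def B_def intro!: bexI[of _ 0])
  qed (use k cB finA in \<open>auto simp: B_def R_def\<close>)
  moreover have "card ((\<Union>i\<in>{..<q}. B i) \<union> R) = n"
  proof -
    have "0 \<in> {..<q}" using q by simp
    then have "{..<q} \<noteq> {}" by blast
    then have "(\<Union>i\<in>{..<q}. B i) \<union> R = insert 0 (\<Union>i<Suc q. A i)"
      by (auto simp: B_def R_def lessThan_Suc)
    then show ?thesis using n by (simp add: A(2) X_def)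
  qed
  moreover have "card ?E \<le> q * Suc k + (if r = 0 then 0 else 1)"
  proof -
    have "card ?E \<le> (\<Sum>i\<in>{..<q}. card (B i) choose k) + (if R = {} then 0 else 1)"
      by (rule card_glued_blocks_le) (simp_all add: B_def finA)
    moreover have "(\<Sum>i\<in>{..<q}. card (B i) choose k) = q * Suc k" using cB by simp
    moreover have "R = {} \<longleftrightarrow> r = 0" using A(1)[of q] finA[of q] by (auto simp: R_def)
    ultimately show ?thesis by simp
  qed
  ultimately show ?thesis by (intro berge_sat_le) (auto simp: q_def r_def)
qed

text \<open>The blocks are \<open>0\<close> with the parts of a partition, of which the first \<open>r\<close> have size \<open>l\<close> and the
  others \<open>l - 1\<close>. The bound on \<open>n\<close> ensures that there are more parts than the \<open>r < l - 1\<close> leftover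
  vertices. A block with \<open>l + 1\<close> vertices has \<open>l choose (k - 1)\<close> edges more than one with \<open>l\<close>, by
  Pascal's rule.\<close>

lemma berge_sat_cycle_two_block_sizes_le:
  assumes k: "2 \<le> k" "k < l" and m: "Suc l < m" "m < 2 * l" and n: "n \<ge> l\<^sup>2"
  shows "berge_sat k n (cycle_graph m)
    \<le> (n - 1) div (l - 1) * (l choose k) + (n - 1) mod (l - 1) * (l choose (k - 1))"
proof -
  define q where "q = (n - 1) div (l - 1)"
  define r where "r = (n - 1) mod (l - 1)"
  have n_eq: "n - 1 = q * (l - 1) + r" unfolding q_def r_def by (simp only: div_mult_mod_eq)
  have rl: "r < l - 1" using k by (simp add: r_def)
  have "(l - 1) * (l - 1) \<le> n - 1"
    using n k by (cases l) (auto simp: power2_eq_square)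
  then have rq: "r < q" using rl k less_eq_div_iff_mult_less_eq[of "l - 1" "l - 1" "n - 1"]
    by (auto simp: q_def)
  have n0: "n > 0" using n k by (cases n) auto
  define X where "X = {1..<n}"
  define s where "s i = (l - 1) + (if i < r then 1 else 0)" for i
  have sum_upto_r: "(\<Sum>i<q. if i < r then c else 0) = r * c" for c :: nat
  proof -
    have "(\<Sum>i<q. if i < r then c else 0) = (\<Sum>i\<in>{..<q} \<inter> {i. i < r}. c)"
      by (simp add: sum.If_cases)
    also have "{..<q} \<inter> {i. i < r} = {..<r}" using rq by auto
    finally show ?thesis by simp
  qed
  have cX: "card X = (\<Sum>i<q. s i)"
    using n_eq sum_upto_r[of 1] by (simp add: X_def s_def sum.distrib)
  have finX: "finite X" by (simp add: X_def)
  obtain A where A: "\<And>i. i < q \<Longrightarrow> card (A i) = s i"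
    "(\<Union>i<q. A i) = X" "\<And>i j. i < q \<Longrightarrow> j < q \<Longrightarrow> i \<noteq> j \<Longrightarrow> A i \<inter> A j = {}"
    by (rule partition_with_sizes[OF finX cX]) auto
  have finA: "finite (A i)" "0 \<notin> A i" if "i < q" for i
  proof -
    have "A i \<subseteq> X" unfolding A(2)[symmetric] using that by (intro UN_upper) simp
    then show "finite (A i)" "0 \<notin> A i" unfolding X_def by (auto intro: finite_subset)
  qed
  define B where "B i = insert 0 (A i)" for i
  have cB: "card (B i) = l + (if i < r then 1 else 0)" if "i < q" for i
    using that finA[of i] A(1)[of i] k by (auto simp: B_def s_def)
  let ?E = "\<Union>i\<in>{..<q}. ksubsets k (B i)"
  have glued: "B i \<inter> B j \<subseteq> {0}" if "i < q" "j < q" "i \<noteq> j" for i j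
    using A(3)[of i j] that by (auto simp: B_def)
  have "berge_saturated k (cycle_graph m) \<lparr>verts = \<Union>i\<in>{..<q}. B i, edges = ?E\<rparr>"
    using berge_saturated_glued_blocks[of k l m "{..<q}" B 0 "{}" "{}"] k m glued
    by (simp add: cB) (simp add: B_def finA)
  moreover have "card (\<Union>i\<in>{..<q}. B i) = n"
  proof -
    have "(\<Union>i\<in>{..<q}. B i) = insert 0 (\<Union>i<q. A i)"
      using rq by (auto simp: B_def)
    then show ?thesis using n0 by (simp add: A(2) X_def)
  qed
  moreover have "card ?E \<le> q * (l choose k) + r * (l choose (k - 1))"
  proof -
    have "card ?E \<le> (\<Sum>i<q. card (B i) choose k)"
      using card_glued_blocks_le[of "{..<q}" B k "{} :: nat set" "{}"] by (simp add: B_def finA)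
    also have "\<dots> = (\<Sum>i<q. (l choose k) + (if i < r then l choose (k - 1) else 0))"
    proof -
      have "Suc l choose k = (l choose k) + (l choose (k - 1))"
        using k by (cases k) auto
      then show ?thesis using cB by (auto intro!: sum.cong)
    qed
    also have "\<dots> = q * (l choose k) + r * (l choose (k - 1))"
      by (simp add: sum.distrib sum_upto_r)
    finally show ?thesis .
  qed
  ultimately show ?thesis by (intro berge_sat_le) (auto simp: q_def r_def)
qed

lemma div_add_le_ceiling_divide:
  assumes "d > 0"
  shows "int (N div d + (if N mod d = 0 then 0 else 1)) \<le> \<lceil>real N / real d\<rceil>"
proof (cases "N mod d = 0")
  case True
  then show ?thesis using floor_le_ceiling[of "real N / real d"]
    by (auto simp: floor_divide_of_nat_eq)
next
  case False
  have "real (N div d) < real N / real d"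
  proof -
    have "N div d * d < N" using False
      by (metis div_mult_mod_eq less_add_same_cancel1 neq0_conv)
    then have "real (N div d) * real d < real N" by (metis of_nat_less_iff of_nat_mult)
    then show ?thesis using assms by (simp add: field_simps)
  qed
  then have "int (N div d) < \<lceil>real N / real d\<rceil>" by (simp add: less_ceiling_iff)
  then show ?thesis using False by simp
qed

theorem theorem5p7:
  fixes k m n :: nat
  assumes "k \<ge> 3" and "m \<ge> 4"
  shows
    "(k \<ge> m - 1 \<and> n > m * (k - (m - 2)) + (m - 2) \<longrightarrow>
        int (berge_sat k n (cycle_graph m))
          \<le> \<lceil>(real n - real m + 2) / (real k - real m + 2)\<rceil>)
   \<and> (k = m - 2 \<and> n \<ge> m^2 \<longrightarrow>
        int (berge_sat k n (cycle_graph m))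
          \<le> \<lfloor>real (n - 1) / real (m - 2)\<rfloor> * int ((m - 1) choose k)
             + \<lceil>real ((n - 1) mod (m - 2)) / real (k - 2)\<rceil>)
   \<and> (\<forall>l::nat. k \<le> m - 3 \<and> l = max (nat \<lceil>real m / 2\<rceil> + 1) (k + 1) \<and> n \<ge> l^2 \<longrightarrow>
        int (berge_sat k n (cycle_graph m))
          \<le> \<lfloor>real (n - 1) / real (l - 1)\<rfloor> * int (l choose k)
             + int (((n - 1) mod (l - 1)) * (l choose (k - 1))))"
proof (intro conjI impI allI; elim conjE)
  assume k: "k \<ge> m - 1" and n: "n > m * (k - (m - 2)) + (m - 2)"
  define d where "d = k - (m - 2)"
  define N where "N = n - (m - 2)"
  have dN: "k = d + (m - 2)" "n = N + (m - 2)" "d \<ge> 1" "m * d \<le> N"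
    using k n assms by (auto simp: d_def N_def)
  then have real_eq: "real N = real n - real m + 2" "real d = real k - real m + 2"
    using assms by (simp_all add: of_nat_diff)
  have "berge_sat k n (cycle_graph m) \<le> N div d + (if N mod d = 0 then 0 else 1)"
    using berge_sat_cycle_common_core_le[of m d N] dN assms by simp
  then have "int (berge_sat k n (cycle_graph m)) \<le> \<lceil>real N / real d\<rceil>"
    using div_add_le_ceiling_divide[of d N] dN(3) by linarith
  then show "int (berge_sat k n (cycle_graph m))
      \<le> \<lceil>(real n - real m + 2) / (real k - real m + 2)\<rceil>"
    unfolding real_eq .
next
  assume k: "k = m - 2" and n: "n \<ge> m^2"
  have m: "m = k + 2" using k assms by auto
  have "n > k" using n m by (simp add: power2_eq_square)
  note le = berge_sat_cycle_pendant_edge_le[OF assms(1) this]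
  define q r where "q = (n - 1) div k" and "r = (n - 1) mod k"
  have "int (if r = 0 then 0 else 1) \<le> \<lceil>real r / real (k - 2)\<rceil>"
    using assms by (simp add: le_ceiling_iff)
  moreover have "int (berge_sat k n (cycle_graph m)) \<le> int (q * Suc k + (if r = 0 then 0 else 1))"
    using le unfolding m q_def r_def of_nat_le_iff .
  moreover have "\<lfloor>real (n - 1) / real k\<rfloor> = int q"
    unfolding q_def by (rule floor_divide_of_nat_eq)
  moreover have "m - 2 = k" "(m - 1) choose k = Suc k" using m by simp_all
  ultimately show "int (berge_sat k n (cycle_graph m))
      \<le> \<lfloor>real (n - 1) / real (m - 2)\<rfloor> * int ((m - 1) choose k)
         + \<lceil>real ((n - 1) mod (m - 2)) / real (k - 2)\<rceil>"
    by (simp only: of_nat_add of_nat_mult r_def)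
next
  fix l :: nat
  assume k: "k \<le> m - 3" and l: "l = max (nat \<lceil>real m / 2\<rceil> + 1) (k + 1)" and n: "n \<ge> l^2"
  have "nat \<lceil>real m / 2\<rceil> = (m + 1) div 2" by linarith
  then have "Suc l < m" "m < 2 * l" "k < l" using k l assms by auto
  then have "berge_sat k n (cycle_graph m)
    \<le> (n - 1) div (l - 1) * (l choose k) + (n - 1) mod (l - 1) * (l choose (k - 1))"
    using n assms by (intro berge_sat_cycle_two_block_sizes_le) auto
  then show "int (berge_sat k n (cycle_graph m))
      \<le> \<lfloor>real (n - 1) / real (l - 1)\<rfloor> * int (l choose k)
         + int (((n - 1) mod (l - 1)) * (l choose (k - 1)))"
    unfolding floor_divide_of_nat_eq by (metis of_nat_add of_nat_le_iff of_nat_mult)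
qed

end
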